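(* Every Paley graph is metamour-complementary and self-complementary. Moreover, for any finite simple graph $G$ there exists a prime power $q\equiv 1 \pmod 4$ such that $G$ embeds as an induced subgraph into the Paley graph $QR(q)$.
   Context: For a prime power $q\equiv 1\pmod 4$, the Paley graph $QR(q)$ has as vertex set the elements of the finite field $\mathbb{F}_q$, two vertices being adjacent if and only if their difference is a nonzero square in $\mathbb{F}_q$. The metamour graph $\operatorname{M}(G)$ of a graph $G$ has vertex set $V(G)$, with $x,y$ adjacent if and only if $d_G(x,y)=2$ ($d_G$ is graph distance). $G$ is metamour-complementary if $\operatorname{M}(G)=\overline{G}$ (the complement of $G$), and self-complementary if $G\cong\overline{G}$. *)

theory Defs
  imports
    "HOL-Number_Theory.Prime_Powers"
    "HOL-Algebra.Ring"
    "HOL-Algebra.Coset"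
    "Graph_Theory.Graph_Theory"
begin

text \<open>
  A finite simple graph is a \<^locale>\<open>pair_graph\<close>: a finite vertex set together with a symmetric,
  irreflexive set of ordered pairs of vertices, so an edge occurs as both of its arcs.
\<close>

text \<open>
  \<^term>\<open>wf_digraph.\<mu>\<close> is the infimum of the walk costs. With unit weights it is the usual graph
  distance, and it is \<^term>\<open>\<infinity> :: ereal\<close> for vertices in different components.
\<close>
definition graph_dist :: "'a pair_pre_digraph \<Rightarrow> 'a \<Rightarrow> 'a \<Rightarrow> ereal" where
  "graph_dist G = wf_digraph.\<mu> (with_proj G) (\<lambda>_. 1)"

definition metamour :: "'a pair_pre_digraph \<Rightarrow> 'a pair_pre_digraph" where
  "metamour G =
     \<lparr> pverts = pverts G,
       parcs = {(x, y). x \<in> pverts G \<and> y \<in> pverts G \<and> graph_dist G x y = 2} \<rparr>"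

definition graph_complement :: "'a pair_pre_digraph \<Rightarrow> 'a pair_pre_digraph" where
  "graph_complement G =
     \<lparr> pverts = pverts G,
       parcs = {(x, y). x \<in> pverts G \<and> y \<in> pverts G \<and> x \<noteq> y \<and> (x, y) \<notin> parcs G} \<rparr>"

definition metamour_complementary :: "'a pair_pre_digraph \<Rightarrow> bool" where
  "metamour_complementary G \<longleftrightarrow> metamour G = graph_complement G"

definition self_complementary :: "'a pair_pre_digraph \<Rightarrow> bool" where
  "self_complementary G \<longleftrightarrow> digraph_iso (with_proj G) (with_proj (graph_complement G))"

definition embeds_induced :: "'a pair_pre_digraph \<Rightarrow> 'b pair_pre_digraph \<Rightarrow> bool" where
  "embeds_induced G P \<longleftrightarrow>
     (\<exists>H. induced_subgraph (with_proj H) (with_proj P) \<and> digraph_iso (with_proj G) (with_proj H))"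

text \<open>
  \<open>F\<close> is a copy of the field with \<open>q\<close> elements. For \<open>q > 0\<close> the second conjunct includes finiteness,
  as \<^const>\<open>order\<close> is the cardinality of the carrier and infinite sets have cardinality 0.
\<close>
definition finite_field_of_order :: "nat \<Rightarrow> ('a, 'm) ring_scheme \<Rightarrow> bool" where
  "finite_field_of_order q F \<longleftrightarrow> field F \<and> order F = q"

text \<open>For a field \<open>F\<close> with \<open>q\<close> elements, \<open>q mod 4 = 1\<close>, this is the Paley graph \<open>QR(q)\<close>.\<close>
definition paley_graph :: "('a, 'm) ring_scheme \<Rightarrow> 'a pair_pre_digraph" where
  "paley_graph F =
     \<lparr> pverts = carrier F,
       parcs = {(x, y). x \<in> carrier F \<and> y \<in> carrier F \<and> x \<ominus>\<^bsub>F\<^esub> y \<noteq> \<zero>\<^bsub>F\<^esub> \<and>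
                  (\<exists>z \<in> carrier F. x \<ominus>\<^bsub>F\<^esub> y = z [^]\<^bsub>F\<^esub> (2::nat))} \<rparr>"

end

theory Submission
  imports Defs "HOL-Algebra.Multiplicative_Group" "HOL-Number_Theory.Residues"
begin

text \<open>
  Everything rests on the quadratic character \<open>\<chi>\<close> of a field with \<open>q\<close> elements, \<open>q mod 4 = 1\<close>.
  It is multiplicative and even, since \<open>-1\<close> is a square, so distinct \<open>x\<close> and \<open>y\<close> are adjacent or
  not according to the sign of \<open>\<chi> (x - y)\<close>. Multiplication by a nonsquare reverses this sign and
  therefore is an isomorphism onto the complement. The other two claims use that shifts of
  \<open>\<chi>\<close> are nearly orthogonal: for \<open>b \<noteq> c\<close> the sum over all \<open>x\<close> of \<open>\<chi> (x - b) * \<chi> (x - c)\<close> is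
  \<open>-1\<close> (lemma \<open>sum_\<chi>_correlation\<close>).

  For the metamour graph this gives that the sum over \<open>a\<close> of \<open>(1 + \<chi> (a - x)) * (1 + \<chi> (a - y))\<close>
  is \<open>q - 1 > 0\<close>. When \<open>x\<close> and \<open>y\<close> are distinct and nonadjacent, only their common neighbours
  contribute, so they have one and their distance is 2 (lemma \<open>common_neighbour\<close>).

  For induced subgraphs, near orthogonality bounds the second moment of the sum of \<open>\<chi> (a - b)\<close>
  over \<open>b\<close> in a set \<open>B\<close>. When \<open>B\<close> is a positive proportion of the field, it follows that all
  but boundedly many \<open>a\<close> are adjacent to at least a quarter of \<open>B\<close> and nonadjacent to at least a
  quarter of it (lemma \<open>few_bad_vertices\<close>). A given graph can then be embedded one vertex at a
  time: every vertex still to be placed keeps a set of admissible positions, and each placement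
  shrinks these sets by a factor of at most 4 (lemma \<open>greedy_embedding\<close>). Hence a graph with \<open>n\<close>
  vertices embeds once \<open>q \<ge> 64 ^ (n + 1)\<close>, and arbitrarily large \<open>q\<close> come from the
  infinitely many primes congruent to 1 modulo 4.
\<close>

section \<open>Primes congruent to 1 modulo 4\<close>

text \<open>
  A prime factor \<open>p\<close> of \<open>x\<^sup>2 + 1\<close> with \<open>x\<close> a factorial is large, because it cannot divide \<open>x\<close>, and it
  makes \<open>-1\<close> a square modulo \<open>p\<close>, which by Fermat's theorem forces \<open>p mod 4 = 1\<close>. The offset 2 in
  the factorial excludes \<open>p = 2\<close>.
\<close>

lemma exists_prime_1_mod_4_gt:
  "\<exists>p::nat. prime p \<and> p mod 4 = 1 \<and> N < p"
proof -
  define x :: nat where "x = fact (N + 2)"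
  have "x ^ 2 + 1 \<noteq> 1"
    by (simp add: x_def)
  then obtain p where p: "prime p" "p dvd x ^ 2 + 1"
    using prime_factor_nat by blast
  have large: "N + 2 < p"
  proof (rule ccontr)
    assume "\<not> N + 2 < p"
    then have "p dvd x"
      unfolding x_def using p(1) by (metis linorder_not_less prime_dvd_fact_iff)
    then have "p dvd x ^ 2"
      by (simp add: power2_eq_square)
    then have "p dvd 1"
      using p(2) dvd_add_right_iff by blast
    then show False
      using p(1) by simp
  qed
  then have "odd p"
    using p(1) by (intro prime_odd_nat) auto
  define h where "h = (p - 1) div 2"
  have h: "p = 2 * h + 1"
    using \<open>odd p\<close> by (auto simp: h_def elim: oddE)
  have "even h"
  proof (rule ccontr)
    assume "odd h"
    have "\<not> p dvd x"
      using p by (metis dvd_add_right_iff dvd_power not_prime_unit zero_less_numeral dvd_trans)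
    then have "[x ^ (p - 1) = 1] (mod p)"
      using p(1) fermat_theorem by blast
    then have "[int x ^ (2 * h) = 1] (mod int p)"
      by (metis add_diff_cancel_right' cong_int_iff h of_nat_1 of_nat_power)
    moreover have "[int x ^ 2 = - 1] (mod int p)"
      using p(2) by (metis cong_iff_dvd_diff diff_minus_eq_add int_dvd_int_iff of_nat_1 of_nat_add of_nat_power)
    then have "[(int x ^ 2) ^ h = (- 1) ^ h] (mod int p)"
      by (rule cong_pow)
    ultimately have "[- 1 = 1] (mod int p)"
      using \<open>odd h\<close> by (metis cong_sym cong_trans power_mult uminus_power_if power_one)
    then have "int p dvd 2"
      by (metis cong_iff_dvd_diff cong_sym diff_minus_eq_add one_add_one)
    then show False
      using large zdvd_imp_le by fastforce
  qed
  then have "p mod 4 = 1"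
    using h by (auto elim!: evenE)
  then show ?thesis
    using p(1) large by auto
qed

section \<open>The quadratic character\<close>

locale paley_field = field R for R :: "('a, 'm) ring_scheme" (structure) +
  assumes order_mod_4: "order R mod 4 = 1"
begin

lemma finite_carrier: "finite (carrier R)"
  using order_mod_4 unfolding order_def by (metis card.infinite mod_0 zero_neq_one)

lemma order_eq: obtains m where "order R = 4 * m + 1" "m > 0"
proof -
  have "order R = 4 * (order R div 4) + 1"
    using order_mod_4 by (metis mult_div_mod_eq)
  moreover have "card {\<zero>, \<one>} \<le> order R"
    unfolding order_def using finite_carrier by (intro card_mono) auto
  ultimately show thesis
    using that[of "order R div 4"] by simp
qed

text \<open>
  The nonzero elements are the powers of one element \<open>g\<close>, and its even powers are exactly the nonzero
  squares: with \<open>h = (q - 1) / 2\<close>, a square has \<open>h\<close>-th power \<open>1\<close>, whereas an odd power of \<open>g\<close> has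
  \<open>h\<close>-th power \<open>g ^ h\<close>. All properties of squares below come from parities of exponents.
\<close>

lemma primitive_root:
  obtains g where "g \<in> carrier R" "g \<noteq> \<zero>" "g [^] (order R - 1) = \<one>"
    "\<And>x. x \<in> carrier R \<Longrightarrow> x \<noteq> \<zero> \<Longrightarrow> \<exists>i::nat. x = g [^] i"
    "\<And>i::nat. (\<exists>z\<in>carrier R. g [^] i = z [^] (2::nat)) \<longleftrightarrow> even i"
    "g [^] ((order R - 1) div 2) \<noteq> \<one>"
proof -
  obtain g where g: "g \<in> carrier R" "g \<noteq> \<zero>"
    and gen: "carrier R - {\<zero>} = {g [^] i | i::nat. i \<in> UNIV}"
    using finite_field_mult_group_has_gen[OF finite_carrier] by auto
  define h where "h = (order R - 1) div 2"
  have ord: "order R = 2 * h + 1" and "h > 0"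
    by (rule order_eq, simp add: h_def)+
  have card: "card (carrier R - {\<zero>}) = 2 * h"
    using finite_carrier ord by (simp add: order_def)
  interpret G: group "mult_of R"
    by (rule field_mult_group)
  have period: "x [^] (2 * h) = \<one>" if "x \<in> carrier R" "x \<noteq> \<zero>" for x
    using G.pow_order_eq_1[of x] that card by (simp add: nat_pow_mult_of order_def)
  \<comment> \<open>Otherwise the powers of \<open>g\<close> would repeat with period \<open>h\<close> and miss half of the nonzero elements.\<close>
  have half: "g [^] h \<noteq> \<one>"
  proof
    assume 1: "g [^] h = \<one>"
    have "g [^] i \<in> (\<lambda>j. g [^] j) ` {..<h}" for i :: nat
    proof -
      have "g [^] i = g [^] (h * (i div h) + i mod h)"
        by simp
      also have "\<dots> = (g [^] h) [^] (i div h) \<otimes> g [^] (i mod h)"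
        using g(1) by (simp add: nat_pow_mult nat_pow_pow)
      also have "\<dots> = g [^] (i mod h)"
        using g(1) 1 by simp
      finally show ?thesis
        using \<open>h > 0\<close> by auto
    qed
    then have "carrier R - {\<zero>} \<subseteq> (\<lambda>j. g [^] j) ` {..<h}"
      using gen by auto
    then have "2 * h \<le> h"
      using card card_mono[OF finite_imageI] card_image_le
      by (metis (no_types, lifting) card_lessThan finite_lessThan le_trans)
    then show False
      using \<open>h > 0\<close> by simp
  qed
  have sq: "(\<exists>z\<in>carrier R. g [^] i = z [^] (2::nat)) \<longleftrightarrow> even i" for i :: nat
  proof
    assume "even i"
    then obtain j where "i = j * 2"
      by (auto elim: evenE)
    then have "g [^] i = (g [^] j) [^] (2::nat)"
      using g(1) by (simp add: nat_pow_pow)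
    then show "\<exists>z\<in>carrier R. g [^] i = z [^] (2::nat)"
      using g(1) by blast
  next
    assume "\<exists>z\<in>carrier R. g [^] i = z [^] (2::nat)"
    then obtain z where z: "z \<in> carrier R" "g [^] i = z [^] (2::nat)"
      by blast
    have "g [^] i \<noteq> \<zero>"
      using gen by blast
    then have "z \<noteq> \<zero>"
      using z by (auto simp: numeral_2_eq_2)
    show "even i"
    proof (rule ccontr)
      assume "odd i"
      then obtain j where j: "i = 2 * j + 1"
        by (auto elim: oddE)
      have "\<one> = (g [^] i) [^] h"
        using z \<open>z \<noteq> \<zero>\<close> period[of z] by (simp add: nat_pow_pow)
      also have "\<dots> = g [^] (i * h)"
        using g(1) by (rule nat_pow_pow)
      also have "i * h = (2 * h) * j + h"
        by (simp add: j)
      also have "g [^] ((2 * h) * j + h) = (g [^] (2 * h)) [^] j \<otimes> g [^] h"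
        using g(1) by (simp add: nat_pow_mult nat_pow_pow)
      also have "\<dots> = g [^] h"
        using g period[of g] by simp
      finally show False
        using half by simp
    qed
  qed
  show thesis
  proof (rule that[OF g])
    show "\<exists>i::nat. x = g [^] i" if "x \<in> carrier R" "x \<noteq> \<zero>" for x
      using gen that by blast
  qed (use g period sq half ord in auto)
qed

text \<open>
  The quadratic character. Its value 0 at \<open>\<zero>\<close> keeps it multiplicative and lets equal vertices,
  which are neither adjacent nor nonadjacent, drop out of the sums.
\<close>

definition \<chi> :: "'a \<Rightarrow> int" where
  "\<chi> x = (if x = \<zero> then 0 else if \<exists>z\<in>carrier R. x = z [^] (2::nat) then 1 else -1)"

lemma \<chi>_zero [simp]: "\<chi> \<zero> = 0"
  by (simp add: \<chi>_def)

lemma \<chi>_self [simp]: "x \<in> carrier R \<Longrightarrow> \<chi> (x \<ominus> x) = 0"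
  by (simp add: a_minus_def r_neg)

lemma \<chi>_nonzero: "x \<noteq> \<zero> \<Longrightarrow> \<chi> x = 1 \<or> \<chi> x = -1"
  by (simp add: \<chi>_def)

lemma \<chi>_eq_1_iff: "\<chi> x = 1 \<longleftrightarrow> x \<noteq> \<zero> \<and> (\<exists>z\<in>carrier R. x = z [^] (2::nat))"
  by (simp add: \<chi>_def)

lemma \<chi>_square: "x \<noteq> \<zero> \<Longrightarrow> \<chi> x * \<chi> x = 1"
  by (simp add: \<chi>_def)

lemma \<chi>_mult:
  assumes "x \<in> carrier R" "y \<in> carrier R"
  shows "\<chi> (x \<otimes> y) = \<chi> x * \<chi> y"
proof (cases "x = \<zero> \<or> y = \<zero>")
  case True
  then show ?thesis
    using assms by auto
next
  case False
  obtain g where g: "g \<in> carrier R"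
    and gen: "\<And>x. x \<in> carrier R \<Longrightarrow> x \<noteq> \<zero> \<Longrightarrow> \<exists>i::nat. x = g [^] i"
    and sq: "\<And>i::nat. (\<exists>z\<in>carrier R. g [^] i = z [^] (2::nat)) \<longleftrightarrow> even i"
    using primitive_root by metis
  obtain i j :: nat where ij: "x = g [^] i" "y = g [^] j"
    using gen assms False by metis
  have xy: "x \<otimes> y = g [^] (i + j)"
    using ij g by (simp add: nat_pow_mult)
  have ne: "x \<otimes> y \<noteq> \<zero>"
    using False assms integral by blast
  show ?thesis
    using False ne unfolding \<chi>_def xy unfolding ij sq by auto
qed

text \<open>
  Here the hypothesis \<open>q mod 4 = 1\<close> is essential: \<open>-1\<close> is the power \<open>g ^ ((q - 1) / 2)\<close> of a primitive
  root, and this exponent is even.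
\<close>

lemma \<chi>_minus_one: "\<chi> (\<ominus> \<one>) = 1"
proof -
  obtain g where g: "g \<in> carrier R"
    and period: "g [^] (order R - 1) = \<one>"
    and sq: "\<And>i::nat. (\<exists>z\<in>carrier R. g [^] i = z [^] (2::nat)) \<longleftrightarrow> even i"
    and half: "g [^] ((order R - 1) div 2) \<noteq> \<one>"
    using primitive_root by metis
  define h where "h = (order R - 1) div 2"
  define x where "x = g [^] h"
  have h: "order R - 1 = h * 2" "even h"
    by (rule order_eq, simp add: h_def)+
  have x: "x \<in> carrier R" "x \<noteq> \<one>"
    using g half by (auto simp: x_def h_def)
  have "x \<otimes> x = g [^] (h * 2)"
    unfolding x_def mult_2_right using g by (rule nat_pow_mult)
  then have "x \<otimes> x = \<one>"
    using period h(1) by simp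
  then have "(x \<ominus> \<one>) \<otimes> (x \<oplus> \<one>) = \<zero>"
    using x(1) by algebra
  moreover have "x \<ominus> \<one> \<noteq> \<zero>"
    using x by simp
  ultimately have "x \<oplus> \<one> = \<zero>"
    using x(1) integral by blast
  then have "x = \<ominus> \<one>"
    using x(1) by (metis minus_equality one_closed)
  moreover have "\<exists>z\<in>carrier R. x = z [^] (2::nat)"
    using sq h(2) by (simp add: x_def)
  ultimately show ?thesis
    by (auto simp: \<chi>_eq_1_iff)
qed

lemma exists_nonsquare: "\<exists>n\<in>carrier R. n \<noteq> \<zero> \<and> \<chi> n = -1"
proof -
  obtain g where g: "g \<in> carrier R" "g \<noteq> \<zero>"
    and sq: "\<And>i::nat. (\<exists>z\<in>carrier R. g [^] i = z [^] (2::nat)) \<longleftrightarrow> even i"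
    using primitive_root by metis
  have "\<not> (\<exists>z\<in>carrier R. g = z [^] (2::nat))"
    using sq[of 1] g by simp
  then have "\<chi> g = -1"
    using g(2) by (simp add: \<chi>_def)
  then show ?thesis
    using g by blast
qed

lemma \<chi>_diff_commute:
  assumes "x \<in> carrier R" "y \<in> carrier R"
  shows "\<chi> (x \<ominus> y) = \<chi> (y \<ominus> x)"
proof -
  have "x \<ominus> y = (\<ominus> \<one>) \<otimes> (y \<ominus> x)"
    using assms by algebra
  then show ?thesis
    using assms by (simp add: \<chi>_mult \<chi>_minus_one)
qed

section \<open>Near orthogonality of the shifts of the character\<close>

lemma bij_betw_scale:
  assumes "d \<in> carrier R" "d \<noteq> \<zero>"
  shows "bij_betw (\<lambda>x. d \<otimes> x) (carrier R) (carrier R)"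
proof -
  have "inj_on (\<lambda>x. d \<otimes> x) (carrier R)"
    using assms by (auto intro!: inj_onI simp: m_lcancel)
  then show ?thesis
    using assms finite_carrier endo_inj_surj[of "carrier R" "\<lambda>x. d \<otimes> x"]
    by (auto simp: bij_betw_def)
qed

lemma sum_scale:
  assumes "d \<in> carrier R" "d \<noteq> \<zero>"
  shows "(\<Sum>x\<in>carrier R. f (d \<otimes> x)) = (\<Sum>x\<in>carrier R. f x)"
  by (rule sum.reindex_bij_betw[OF bij_betw_scale[OF assms]])

lemma sum_translate:
  assumes "b \<in> carrier R"
  shows "(\<Sum>x\<in>carrier R. f (x \<ominus> b)) = (\<Sum>x\<in>carrier R. f x)"
  by (rule sum.reindex_bij_witness[of _ "\<lambda>x. x \<oplus> b" "\<lambda>x. x \<ominus> b"])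
     (use assms in \<open>auto, algebra+\<close>)

text \<open>
  Scaling by a nonsquare permutes the summands and changes the sign of the sum.
\<close>

lemma sum_\<chi>: "(\<Sum>x\<in>carrier R. \<chi> x) = 0"
proof -
  obtain n where n: "n \<in> carrier R" "n \<noteq> \<zero>" "\<chi> n = -1"
    using exists_nonsquare by blast
  have "(\<Sum>x\<in>carrier R. \<chi> x) = (\<Sum>x\<in>carrier R. \<chi> (n \<otimes> x))"
    using sum_scale[OF n(1,2), of \<chi>] by simp
  also have "\<dots> = (\<Sum>x\<in>carrier R. - \<chi> x)"
    using n by (intro sum.cong) (auto simp: \<chi>_mult)
  finally show ?thesis
    by (simp add: sum_negf)
qed

lemma sum_\<chi>_translate:
  assumes "b \<in> carrier R"
  shows "(\<Sum>x\<in>carrier R. \<chi> (x \<ominus> b)) = 0"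
  using sum_translate[OF assms, of \<chi>] sum_\<chi> by simp

lemma card_nonzero: "int (card (carrier R - {\<zero>})) = int (order R) - 1"
proof -
  have "Suc (card (carrier R - {\<zero>})) = order R"
    unfolding order_def using finite_carrier by (intro card_Suc_Diff1) auto
  then show ?thesis by linarith
qed

lemma sum_\<chi>_translate_squared:
  assumes "b \<in> carrier R"
  shows "(\<Sum>x\<in>carrier R. \<chi> (x \<ominus> b) * \<chi> (x \<ominus> b)) = int (order R) - 1"
proof -
  have "(\<Sum>x\<in>carrier R. \<chi> (x \<ominus> b) * \<chi> (x \<ominus> b)) = (\<Sum>x\<in>carrier R. \<chi> x * \<chi> x)"
    by (rule sum_translate[OF assms, of "\<lambda>x. \<chi> x * \<chi> x"])
  also have "\<dots> = (\<Sum>x\<in>carrier R. if x = \<zero> then 0 else 1)"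
    by (intro sum.cong) (auto simp: \<chi>_square)
  also have "\<dots> = int (card (carrier R - {\<zero>}))"
    using finite_carrier by (simp add: sum.remove[of _ \<zero>])
  also have "\<dots> = int (order R) - 1"
    by (rule card_nonzero)
  finally show ?thesis .
qed

text \<open>
  After a translation the sum is \<open>T d\<close>, the correlation of \<open>\<chi>\<close> with its shift by \<open>d = c - b\<close>. Scaling the
  variable by \<open>d\<close> shows that \<open>T d\<close> is the same for all nonzero \<open>d\<close>. Summing over all \<open>d\<close> gives 0,
  as \<open>\<chi>\<close> itself sums to 0, and \<open>T 0 = q - 1\<close>; so the \<open>q - 1\<close> equal values must each be \<open>-1\<close>.
\<close>

lemma sum_\<chi>_correlation:
  assumes "b \<in> carrier R" "c \<in> carrier R" "b \<noteq> c"
  shows "(\<Sum>x\<in>carrier R. \<chi> (x \<ominus> b) * \<chi> (x \<ominus> c)) = -1"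
proof -
  define T where "T d = (\<Sum>x\<in>carrier R. \<chi> x * \<chi> (x \<ominus> d))" for d
  have const: "T d = T \<one>" if d: "d \<in> carrier R" "d \<noteq> \<zero>" for d
  proof -
    have "T d = (\<Sum>x\<in>carrier R. \<chi> (d \<otimes> x) * \<chi> (d \<otimes> x \<ominus> d))"
      unfolding T_def using sum_scale[OF d, of "\<lambda>x. \<chi> x * \<chi> (x \<ominus> d)"] by simp
    also have "\<dots> = T \<one>"
      unfolding T_def
    proof (intro sum.cong refl)
      fix x assume x: "x \<in> carrier R"
      have "d \<otimes> x \<ominus> d = d \<otimes> (x \<ominus> \<one>)"
        using d(1) x by algebra
      then have "\<chi> (d \<otimes> x) * \<chi> (d \<otimes> x \<ominus> d) = (\<chi> d * \<chi> d) * (\<chi> x * \<chi> (x \<ominus> \<one>))"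
        using d(1) x by (simp add: \<chi>_mult)
      then show "\<chi> (d \<otimes> x) * \<chi> (d \<otimes> x \<ominus> d) = \<chi> x * \<chi> (x \<ominus> \<one>)"
        using d(2) by (simp add: \<chi>_square)
    qed
    finally show ?thesis .
  qed
  have "(\<Sum>d\<in>carrier R. T d) = (\<Sum>x\<in>carrier R. \<chi> x * (\<Sum>d\<in>carrier R. \<chi> (x \<ominus> d)))"
    unfolding T_def sum_distrib_left by (rule sum.swap)
  also have "\<dots> = (\<Sum>x\<in>carrier R. \<chi> x * (\<Sum>d\<in>carrier R. \<chi> (d \<ominus> x)))"
    by (intro sum.cong refl arg_cong2[of _ _ _ _ "(*)"] \<chi>_diff_commute)
  also have "\<dots> = 0"
    by (simp add: sum_\<chi>_translate)
  finally have "(\<Sum>d\<in>carrier R. T d) = 0" .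
  then have "T \<zero> + (\<Sum>d\<in>carrier R - {\<zero>}. T d) = 0"
    using sum.remove[OF finite_carrier zero_closed, of T] by simp
  moreover have "(\<Sum>d\<in>carrier R - {\<zero>}. T d) = (int (order R) - 1) * T \<one>"
  proof -
    have "(\<Sum>d\<in>carrier R - {\<zero>}. T d) = (\<Sum>d\<in>carrier R - {\<zero>}. T \<one>)"
      by (intro sum.cong) (auto intro: const)
    then show ?thesis
      by (simp only: sum_constant card_nonzero)
  qed
  moreover have "T \<zero> = int (order R) - 1"
    unfolding T_def sum_\<chi>_translate_squared[OF zero_closed, symmetric]
    by (intro sum.cong) (auto simp: a_minus_def)
  ultimately have "(int (order R) - 1) * (1 + T \<one>) = 0"
    by (simp add: algebra_simps)
  moreover have "int (order R) \<noteq> 1"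
    by (rule order_eq) simp
  ultimately have "T \<one> = -1"
    by auto
  moreover have "(\<Sum>x\<in>carrier R. \<chi> (x \<ominus> b) * \<chi> (x \<ominus> c)) = T (c \<ominus> b)"
  proof -
    have "T (c \<ominus> b) = (\<Sum>x\<in>carrier R. \<chi> (x \<ominus> b) * \<chi> ((x \<ominus> b) \<ominus> (c \<ominus> b)))"
      unfolding T_def using sum_translate[OF assms(1), of "\<lambda>x. \<chi> x * \<chi> (x \<ominus> (c \<ominus> b))"] by simp
    also have "\<dots> = (\<Sum>x\<in>carrier R. \<chi> (x \<ominus> b) * \<chi> (x \<ominus> c))"
    proof (intro sum.cong refl)
      fix x assume "x \<in> carrier R"
      then have "(x \<ominus> b) \<ominus> (c \<ominus> b) = x \<ominus> c"
        using assms by algebra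
      then show "\<chi> (x \<ominus> b) * \<chi> ((x \<ominus> b) \<ominus> (c \<ominus> b)) = \<chi> (x \<ominus> b) * \<chi> (x \<ominus> c)"
        by simp
    qed
    finally show ?thesis by simp
  qed
  ultimately show ?thesis
    using const[of "c \<ominus> b"] assms by (metis minus_closed r_right_minus_eq)
qed

section \<open>Common neighbours and unbalanced neighbourhoods\<close>

text \<open>
  The sum below would count the common neighbours four times each, all other terms being 0: if \<open>a\<close> is
  \<open>x\<close> or \<open>y\<close>, one factor is \<open>1 + \<chi> (x - y) = 0\<close> up to the order of the arguments.
  Since the sum is \<open>q - 1\<close>, it does not vanish.
\<close>

lemma common_neighbour:
  assumes x: "x \<in> carrier R" and y: "y \<in> carrier R" and ne: "x \<noteq> y" and non: "\<chi> (x \<ominus> y) = -1"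
  shows "\<exists>a\<in>carrier R. \<chi> (x \<ominus> a) = 1 \<and> \<chi> (a \<ominus> y) = 1"
proof (rule ccontr)
  assume none: "\<not> ?thesis"
  have "(\<Sum>a\<in>carrier R. (1 + \<chi> (a \<ominus> x)) * (1 + \<chi> (a \<ominus> y))) = 
      int (order R) - 1"
    using sum_\<chi>_translate[OF x] sum_\<chi>_translate[OF y] sum_\<chi>_correlation[OF x y ne]
    by (simp add: algebra_simps sum.distrib order_def)
  moreover have "(1 + \<chi> (a \<ominus> x)) * (1 + \<chi> (a \<ominus> y)) = 0" if a: "a \<in> carrier R" for a
  proof -
    consider "a = x" | "a = y" | "\<chi> (a \<ominus> x) = -1" | "\<chi> (a \<ominus> y) = -1"
      using none a x y \<chi>_diff_commute \<chi>_nonzero by (metis r_right_minus_eq)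
    then show ?thesis
      by cases (use non x y \<chi>_diff_commute[of x y] in auto)
  qed
  ultimately have "int (order R) = 1"
    by simp
  moreover have "card {x, y} \<le> order R"
    unfolding order_def using finite_carrier x y by (intro card_mono) auto
  ultimately show False
    using ne by simp
qed

text \<open>
  Expanding the square leaves \<open>q - 1\<close> for each diagonal pair and \<open>-1\<close> for each other pair; the latter
  may be dropped from an upper bound.
\<close>

lemma second_moment:
  assumes B: "B \<subseteq> carrier R"
  shows "(\<Sum>a\<in>carrier R. (\<Sum>b\<in>B. \<chi> (a \<ominus> b))\<^sup>2) \<le> int (order R) * int (card B)"
proof -
  have fin: "finite B"
    by (rule finite_subset[OF B finite_carrier])
  have "(\<Sum>a\<in>carrier R. (\<Sum>b\<in>B. \<chi> (a \<ominus> b))\<^sup>2)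
      = (\<Sum>b\<in>B. \<Sum>a\<in>carrier R. \<Sum>c\<in>B. \<chi> (a \<ominus> b) * \<chi> (a \<ominus> c))"
    unfolding power2_eq_square sum_product by (rule sum.swap)
  also have "\<dots> = (\<Sum>b\<in>B. \<Sum>c\<in>B. \<Sum>a\<in>carrier R. \<chi> (a \<ominus> b) * \<chi> (a \<ominus> c))"
    by (intro sum.cong refl sum.swap)
  also have "\<dots> \<le> (\<Sum>b\<in>B. \<Sum>c\<in>B. if b = c then int (order R) else 0)"
  proof (intro sum_mono)
    fix b c assume "b \<in> B" "c \<in> B"
    then have "b \<in> carrier R" "c \<in> carrier R"
      using B by auto
    then show "(\<Sum>a\<in>carrier R. \<chi> (a \<ominus> b) * \<chi> (a \<ominus> c)) \<le> (if b = c then int (order R) else 0)"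
      using sum_\<chi>_translate_squared[of b] sum_\<chi>_correlation[of b c] by auto
  qed
  also have "\<dots> = int (order R) * int (card B)"
    using fin by simp
  finally show ?thesis .
qed

text \<open>
  A vertex \<open>a\<close> is bad if fewer than a quarter of the \<open>b\<close> in \<open>B\<close> have \<open>\<chi> (a - b) = s\<close>. Then
  the sum of \<open>\<chi> (a - b)\<close> over \<open>B\<close> has absolute value at least \<open>card B / 4\<close>, and
  Chebyshev's argument bounds the number of such \<open>a\<close> by the second moment.
\<close>

lemma few_bad_vertices:
  assumes B: "B \<subseteq> carrier R" "2 \<le> card B" and s: "s = 1 \<or> s = -1"
  shows "card {a \<in> carrier R. 4 * card {b \<in> B. \<chi> (a \<ominus> b) = s} < card B} * card B
         \<le> 16 * order R"
    (is "card ?A * _ \<le> _")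
proof -
  have fin: "finite B"
    by (rule finite_subset[OF B(1) finite_carrier])
  have large: "(int (card B))\<^sup>2 \<le> 16 * (\<Sum>b\<in>B. \<chi> (a \<ominus> b))\<^sup>2" if a: "a \<in> ?A" for a
  proof -
    define N where "N = card {b \<in> B. \<chi> (a \<ominus> b) = s}"
    \<comment> \<open>Since \<open>\<chi> (a \<ominus> a) = 0\<close>, the element \<open>a\<close> of \<open>B\<close>, if present, exceeds the value \<open>-1\<close> by one.\<close>
    have "(\<Sum>b\<in>B. s * \<chi> (a \<ominus> b)) \<le>
        (\<Sum>b\<in>B. (if \<chi> (a \<ominus> b) = s then 2 else 0) + (if b = a then 1 else 0) - 1)"
    proof (intro sum_mono)
      fix b assume "b \<in> B"
      then have "a \<in> carrier R" "b \<in> carrier R"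
        using a B by auto
      then have "b = a \<or> \<chi> (a \<ominus> b) = 1 \<or> \<chi> (a \<ominus> b) = -1"
        using \<chi>_nonzero by (metis r_right_minus_eq)
      then show "s * \<chi> (a \<ominus> b) \<le> (if \<chi> (a \<ominus> b) = s then 2 else 0) + (if b = a then 1 else 0) - 1"
        using s \<open>a \<in> carrier R\<close> by auto
    qed
    also have "\<dots> \<le> 2 * int N + 1 - int (card B)"
      using fin by (simp add: sum.distrib sum_subtractf N_def sum.If_cases Int_def)
    finally have "s * (\<Sum>b\<in>B. \<chi> (a \<ominus> b)) \<le> 2 * int N + 1 - int (card B)"
      by (simp add: sum_distrib_left)
    then have "int (card B) \<le> 4 * (- (s * (\<Sum>b\<in>B. \<chi> (a \<ominus> b))))"
      using a B(2) unfolding N_def by simp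
    then have "(int (card B))\<^sup>2 \<le> (4 * (- (s * (\<Sum>b\<in>B. \<chi> (a \<ominus> b)))))\<^sup>2"
      by (intro power_mono) auto
    then show ?thesis
      using s by (auto simp: power_mult_distrib)
  qed
  have "int (card ?A) * (int (card B))\<^sup>2 = (\<Sum>a\<in>?A. (int (card B))\<^sup>2)"
    by simp
  also have "\<dots> \<le> (\<Sum>a\<in>?A. 16 * (\<Sum>b\<in>B. \<chi> (a \<ominus> b))\<^sup>2)"
    by (intro sum_mono large)
  also have "\<dots> \<le> (\<Sum>a\<in>carrier R. 16 * (\<Sum>b\<in>B. \<chi> (a \<ominus> b))\<^sup>2)"
    using finite_carrier by (intro sum_mono2) auto
  also have "\<dots> \<le> 16 * (int (order R) * int (card B))"
    using second_moment[OF B(1)] by (simp add: sum_distrib_left[symmetric])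
  finally have "int (card ?A) * int (card B) * int (card B) \<le> 16 * int (order R) * int (card B)"
    by (simp add: power2_eq_square algebra_simps)
  then have "int (card ?A) * int (card B) \<le> 16 * int (order R)"
    using B(2) by (subst (asm) mult_le_cancel_right_pos) auto
  then have "int (card ?A * card B) \<le> int (16 * order R)"
    by (simp only: of_nat_mult of_nat_numeral)
  then show ?thesis
    by (simp only: of_nat_le_iff)
qed

section \<open>Embedding one vertex at a time\<close>

text \<open>
  The vertices in \<open>V\<close> are still to be placed, \<open>B v\<close> is the set of positions for \<open>v\<close> compatible with
  the vertices placed so far, and its density is at least \<open>1 / K\<close>. Placing a vertex outside the bad
  sets turns \<open>K\<close> into \<open>4 * K\<close>, so \<open>K\<^sup>2\<close> grows by the factor 16, which the loss of a factor 64
  in the size condition absorbs. There are at most \<open>16 * K\<close> bad positions for each remaining vertex,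
  and \<open>B v\<close> is larger than all of them together.
\<close>

lemma greedy_embedding:
  assumes "finite V"
    and "\<And>v. v \<in> V \<Longrightarrow> B v \<subseteq> carrier R" and "\<And>v. v \<in> V \<Longrightarrow> order R \<le> K * card (B v)"
    and "1 \<le> K" and "K\<^sup>2 * 64 ^ (card V + 1) \<le> order R"
    and s: "\<And>u v. s u v = 1 \<or> s u v = -1" "\<And>u v. s u v = s v u"
  shows "\<exists>f. \<forall>v\<in>V. f v \<in> B v \<and> (\<forall>u\<in>V. u \<noteq> v \<longrightarrow> \<chi> (f u \<ominus> f v) = s u v)"
  using assms(1-5)
proof (induction V arbitrary: B K rule: finite_induct)
  case empty
  then show ?case by simp
next
  case (insert v W)
  define Bad where
    "Bad w = {a \<in> carrier R. 4 * card {b \<in> B w. \<chi> (a \<ominus> b) = s v w} < card (B w)}" for w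
  have cardV: "card (insert v W) = card W + 1"
    using insert.hyps by simp
  have q: "K\<^sup>2 * (64 * (64 * 64 ^ card W)) \<le> order R"
    using insert.prems(4) cardV by simp
  have big: "64 \<le> card (B w)" if "w \<in> insert v W" for w
  proof -
    have "K * (K * (64 * (64 * 64 ^ card W))) \<le> K * card (B w)"
      using order.trans[OF q insert.prems(2)[OF that]]
      by (simp only: power2_eq_square mult.assoc)
    then have "K * (64 * (64 * 64 ^ card W)) \<le> card (B w)"
      using insert.prems(3) by simp
    moreover have "1 * (64 * (1 * 1)) \<le> K * (64 * (64 * 64 ^ card W))"
      using insert.prems(3) by (intro mult_le_mono) auto
    ultimately show ?thesis by linarith
  qed
  have bad: "card (Bad w) \<le> 16 * K" if w: "w \<in> W" for w
  proof -
    have "card (Bad w) * card (B w) \<le> 16 * order R"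
      unfolding Bad_def using insert.prems(1)[of w] big[of w] w s(1)
      by (intro few_bad_vertices) auto
    also have "\<dots> \<le> 16 * K * card (B w)"
      using insert.prems(2)[of w] w by simp
    finally show ?thesis
      using big[of w] w by simp
  qed
  have "card (\<Union>w\<in>W. Bad w) \<le> (\<Sum>w\<in>W. card (Bad w))"
    using insert.hyps by (intro card_UN_le)
  also have "\<dots> \<le> card W * (16 * K)"
    using bad sum_bounded_above[of W "\<lambda>w. card (Bad w)" "16 * K"] by simp
  also have "\<dots> < card (B v)"
  proof -
    have "card W < 64 ^ card W"
      by (rule power_gt_expt) simp
    then have "K\<^sup>2 * (16 * card W) < K\<^sup>2 * (64 * (64 * 64 ^ card W))"
      using insert.prems(3) by (intro mult_strict_left_mono) auto
    also have "\<dots> \<le> K * card (B v)"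
      using q insert.prems(2)[of v] by simp
    finally have "K * (card W * (16 * K)) < K * card (B v)"
      by (simp add: power2_eq_square algebra_simps)
    then show ?thesis by simp
  qed
  finally have "\<not> B v \<subseteq> (\<Union>w\<in>W. Bad w)"
    using insert.hyps finite_carrier card_mono[of "\<Union>w\<in>W. Bad w" "B v"]
    by (auto simp: Bad_def)
  then obtain a where a: "a \<in> B v" "\<And>w. w \<in> W \<Longrightarrow> a \<notin> Bad w"
    by blast
  have a_car: "a \<in> carrier R"
    using a(1) insert.prems(1) by blast
  define B' where "B' w = {b \<in> B w. \<chi> (a \<ominus> b) = s v w}" for w
  have "\<exists>f. \<forall>w\<in>W. f w \<in> B' w \<and> (\<forall>u\<in>W. u \<noteq> w \<longrightarrow> \<chi> (f u \<ominus> f w) = s u w)"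
  proof (rule insert.IH[of B' "4 * K"])
    fix w assume w: "w \<in> W"
    show "B' w \<subseteq> carrier R"
      using insert.prems(1)[of w] w by (auto simp: B'_def)
    have "card (B w) \<le> 4 * card (B' w)"
      using a(2)[OF w] a_car by (simp add: Bad_def B'_def)
    then have "K * card (B w) \<le> K * (4 * card (B' w))"
      by (rule mult_le_mono2)
    moreover have "order R \<le> K * card (B w)"
      using insert.prems(2) w by blast
    ultimately show "order R \<le> 4 * K * card (B' w)"
      by linarith
  next
    show "1 \<le> 4 * K"
      using insert.prems(3) by simp
    have "(4 * K)\<^sup>2 * 64 ^ (card W + 1) = K\<^sup>2 * (16 * (64 * 64 ^ card W))"
      by (simp add: power2_eq_square)
    also have "\<dots> \<le> K\<^sup>2 * (64 * (64 * 64 ^ card W))"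
      by (intro mult_le_mono) auto
    finally show "(4 * K)\<^sup>2 * 64 ^ (card W + 1) \<le> order R"
      using q by linarith
  qed
  then obtain f where f: "\<And>w. w \<in> W \<Longrightarrow> f w \<in> B' w"
    "\<And>u w. u \<in> W \<Longrightarrow> w \<in> W \<Longrightarrow> u \<noteq> w \<Longrightarrow> \<chi> (f u \<ominus> f w) = s u w"
    by blast
  have new: "\<chi> (a \<ominus> f w) = s v w" "\<chi> (f w \<ominus> a) = s w v" "f w \<in> B w" if w: "w \<in> W" for w
  proof -
    show 1: "\<chi> (a \<ominus> f w) = s v w" and 2: "f w \<in> B w"
      using f(1)[OF w] by (auto simp: B'_def)
    have "f w \<in> carrier R"
      using 2 insert.prems(1)[of w] w by auto
    then show "\<chi> (f w \<ominus> a) = s w v"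
      using 1 s(2) a_car \<chi>_diff_commute by metis
  qed
  define g where "g = f(v := a)"
  have g: "g v = a" "\<And>w. w \<in> W \<Longrightarrow> g w = f w"
    using insert.hyps(2) by (auto simp: g_def)
  show ?case
  proof (rule exI[of _ g], intro ballI conjI impI)
    fix w assume "w \<in> insert v W"
    then show "g w \<in> B w"
      using a(1) new(3) g by (metis insertE)
  next
    fix w u assume wu: "w \<in> insert v W" "u \<in> insert v W" "u \<noteq> w"
    then consider "u = v" "w \<in> W" | "u \<in> W" "w = v" | "u \<in> W" "w \<in> W"
      by blast
    then show "\<chi> (g u \<ominus> g w) = s u w"
      by cases (use wu(3) g new f(2) in auto)
  qed
qed

end

section \<open>Distance two and isomorphisms\<close>

lemma graph_dist_eq_2_iff:
  assumes "pair_wf_digraph G"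
  shows "graph_dist G x y = 2 \<longleftrightarrow>
    x \<noteq> y \<and> (x, y) \<notin> parcs G \<and> (\<exists>z. (x, z) \<in> parcs G \<and> (z, y) \<in> parcs G)" (is "_ \<longleftrightarrow> ?R")
proof -
  interpret pair_wf_digraph G by fact
  have cost: "awalk_cost (\<lambda>_. 1) p = length p" for p :: "('a \<times> 'a) list"
    by (induction p) auto
  have dist: "graph_dist G x y = (INF p\<in>{p. awalk x p y}. ereal (length p))"
    unfolding graph_dist_def \<mu>_def cost by simp
  \<comment> \<open>The distance is an infimum over walks, so the lower bound has to hold for every walk.\<close>
  have two: "ereal 2 \<le> ereal (length p)"
    if "x \<noteq> y" "(x, y) \<notin> parcs G" "awalk x p y" for p
  proof -
    have "length p \<noteq> 0"
      using that by (auto simp: awalk_Nil_iff)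
    moreover have "length p \<noteq> 1"
      using that by (auto simp: length_Suc_conv awalk_Cons_iff awalk_Nil_iff)
    ultimately have "2 \<le> length p"
      by linarith
    then show ?thesis by simp
  qed
  show ?thesis
  proof
    assume R: ?R
    then obtain z where z: "(x, z) \<in> parcs G" "(z, y) \<in> parcs G"
      by blast
    have "awalk x [(x, z), (z, y)] y"
      using z by (auto simp: awalk_Cons_iff awalk_Nil_iff dest: in_arcsD2)
    then have "graph_dist G x y \<le> ereal (length [(x, z), (z, y)])"
      unfolding dist by (intro INF_lower) simp
    moreover have "ereal 2 \<le> graph_dist G x y"
      unfolding dist using two R by (intro INF_greatest) auto
    ultimately show "graph_dist G x y = 2"
      by (simp add: antisym)
  next
    assume 2: "graph_dist G x y = 2"
    have lower: "2 \<le> length p" if "awalk x p y" for p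
    proof -
      have "graph_dist G x y \<le> ereal (length p)"
        unfolding dist using that by (intro INF_lower) simp
      then show ?thesis using 2 by simp
    qed
    \<comment> \<open>The infimum is below 3, so some walk is shorter than 3, and none is shorter than 2.\<close>
    have "graph_dist G x y < ereal 3"
      using 2 by simp
    then obtain p where p: "awalk x p y" "length p < 3"
      unfolding dist by (auto simp: INF_less_iff)
    then have "length p = 2"
      using lower[of p] by simp
    then obtain z where "(x, z) \<in> parcs G" "(z, y) \<in> parcs G"
      using p(1) by (auto simp: length_Suc_conv numeral_2_eq_2 awalk_Cons_iff awalk_Nil_iff)
    moreover have "x \<noteq> y"
      using lower[of "[]"] calculation in_arcsD1 by (auto simp: awalk_Nil_iff)
    moreover have "(x, y) \<notin> parcs G"
      using lower[of "[(x, y)]"] in_arcsD2 by (auto simp: awalk_Nil_iff awalk_Cons_iff)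
    ultimately show ?R by blast
  qed
qed

lemma digraph_isoI:
  assumes G: "pair_wf_digraph G" and H: "pair_wf_digraph H"
    and f: "bij_betw f (pverts G) (pverts H)"
    and arcs: "\<And>x y. x \<in> pverts G \<Longrightarrow> y \<in> pverts G \<Longrightarrow> (x, y) \<in> parcs G \<longleftrightarrow> (f x, f y) \<in> parcs H"
  shows "digraph_iso (with_proj G) (with_proj H)"
proof -
  interpret G: pair_wf_digraph G by fact
  interpret H: pair_wf_digraph H by fact
  define h where "h = \<lparr>iso_verts = f, iso_arcs = map_prod f f, iso_head = snd, iso_tail = fst\<rparr>"
  have inj: "inj_on f (pverts G)" and img: "f ` pverts G = pverts H"
    using f by (auto simp: bij_betw_def)
  have sub: "parcs G \<subseteq> pverts G \<times> pverts G"
    by (auto dest: G.in_arcsD1 G.in_arcsD2)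
  have "inj_on (map_prod f f) (parcs G)"
    using map_prod_inj_on[OF inj inj] sub inj_on_subset by blast
  then have "pre_digraph.digraph_isomorphism (with_proj G) h"
    unfolding pre_digraph.digraph_isomorphism_def
    using inj G.wf_digraph_axioms by (simp add: h_def)
  moreover have "map_prod f f ` parcs G = parcs H"
  proof
    show "map_prod f f ` parcs G \<subseteq> parcs H"
      using arcs sub by auto
    show "parcs H \<subseteq> map_prod f f ` parcs G"
    proof
      fix e assume e: "e \<in> parcs H"
      then have "fst e \<in> f ` pverts G" "snd e \<in> f ` pverts G"
        using img H.arc_fst_in_verts H.arc_snd_in_verts by auto
      then obtain x y where "x \<in> pverts G" "y \<in> pverts G" "e = (f x, f y)"
        by (metis imageE prod.collapse)
      then show "e \<in> map_prod f f ` parcs G"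
        using arcs e by force
    qed
  qed
  then have "with_proj H = app_iso h (with_proj G)"
    using img by (simp add: app_iso_def h_def with_proj_def)
  ultimately show ?thesis
    unfolding digraph_iso_def by blast
qed

section \<open>Paley graphs\<close>

context paley_field
begin

lemma paley_arc_iff:
  "(x, y) \<in> parcs (paley_graph R) \<longleftrightarrow> x \<in> carrier R \<and> y \<in> carrier R \<and> \<chi> (x \<ominus> y) = 1"
  by (auto simp: paley_graph_def \<chi>_eq_1_iff)

lemma pverts_paley [simp]: "pverts (paley_graph R) = carrier R"
  by (simp add: paley_graph_def)

lemma pair_wf_digraph_paley: "pair_wf_digraph (paley_graph R)"
  by unfold_locales (auto simp: paley_graph_def)

lemma nonadjacent_iff:
  assumes "x \<in> carrier R" "y \<in> carrier R" "x \<noteq> y"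
  shows "(x, y) \<notin> parcs (paley_graph R) \<longleftrightarrow> \<chi> (x \<ominus> y) = -1"
  using assms \<chi>_nonzero[of "x \<ominus> y"] by (auto simp: paley_arc_iff)

lemma paley_metamour_complementary: "metamour_complementary (paley_graph R)"
proof -
  have "graph_dist (paley_graph R) x y = 2 \<longleftrightarrow> x \<noteq> y \<and> (x, y) \<notin> parcs (paley_graph R)"
    if "x \<in> carrier R" "y \<in> carrier R" for x y
    using common_neighbour[OF that] nonadjacent_iff[OF that] that
    unfolding graph_dist_eq_2_iff[OF pair_wf_digraph_paley] by (auto simp: paley_arc_iff)
  then show ?thesis
    by (auto simp: metamour_complementary_def metamour_def graph_complement_def)
qed

lemma paley_self_complementary: "self_complementary (paley_graph R)"
proof -
  obtain n where n: "n \<in> carrier R" "n \<noteq> \<zero>" "\<chi> n = -1"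
    using exists_nonsquare by blast
  show ?thesis
    unfolding self_complementary_def
  proof (rule digraph_isoI[where f = "\<lambda>x. n \<otimes> x"])
    show "pair_wf_digraph (graph_complement (paley_graph R))"
      by unfold_locales (auto simp: graph_complement_def)
    show "bij_betw (\<lambda>x. n \<otimes> x) (pverts (paley_graph R)) (pverts (graph_complement (paley_graph R)))"
      using bij_betw_scale[OF n(1,2)] by (simp add: graph_complement_def)
    fix x y assume "x \<in> pverts (paley_graph R)" "y \<in> pverts (paley_graph R)"
    then have xy: "x \<in> carrier R" "y \<in> carrier R"
      by simp_all
    have "n \<otimes> x \<ominus> n \<otimes> y = n \<otimes> (x \<ominus> y)"
      using xy n(1) by algebra
    then have flip: "\<chi> (n \<otimes> x \<ominus> n \<otimes> y) = - \<chi> (x \<ominus> y)"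
      using xy n by (simp add: \<chi>_mult)
    show "(x, y) \<in> parcs (paley_graph R) \<longleftrightarrow>
        (n \<otimes> x, n \<otimes> y) \<in> parcs (graph_complement (paley_graph R))"
    proof (cases "x = y")
      case True
      then show ?thesis
        using xy by (auto simp: paley_arc_iff graph_complement_def)
    next
      case False
      then have ne: "n \<otimes> x \<noteq> n \<otimes> y"
        using xy n by (simp add: m_lcancel)
      show ?thesis
        using nonadjacent_iff[of "n \<otimes> x" "n \<otimes> y"] ne flip xy n(1)
        by (simp add: graph_complement_def paley_arc_iff)
    qed
  qed (rule pair_wf_digraph_paley)
qed

text \<open>
  Prescribing nonzero values of \<open>\<chi>\<close> on all differences also makes the placement injective. At the
  start every vertex may be placed anywhere, which is the density \<open>1 / K\<close> with \<open>K = 1\<close>.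
\<close>

lemma paley_embeds_induced:
  assumes "pair_graph G" and large: "64 ^ (card (pverts G) + 1) \<le> order R"
  shows "embeds_induced G (paley_graph R)"
proof -
  interpret G: pair_graph G by fact
  define s :: "'b \<Rightarrow> 'b \<Rightarrow> int" where "s u v = (if (u, v) \<in> parcs G then 1 else -1)" for u v
  have arc_sym: "(u, v) \<in> parcs G \<longleftrightarrow> (v, u) \<in> parcs G" for u v
    using G.pair_sym_arcs by (auto simp: symmetric_def dest: symD)
  have "\<exists>f. \<forall>v\<in>pverts G. f v \<in> carrier R \<and>
      (\<forall>u\<in>pverts G. u \<noteq> v \<longrightarrow> \<chi> (f u \<ominus> f v) = s u v)"
    by (rule greedy_embedding[where K = 1])
       (use large G.pair_finite_verts arc_sym in \<open>auto simp: order_def s_def\<close>)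
  then obtain f where f: "\<And>v. v \<in> pverts G \<Longrightarrow> f v \<in> carrier R"
    "\<And>u v. u \<in> pverts G \<Longrightarrow> v \<in> pverts G \<Longrightarrow> u \<noteq> v \<Longrightarrow> \<chi> (f u \<ominus> f v) = s u v"
    by blast
  have inj: "inj_on f (pverts G)"
  proof (rule inj_onI, rule ccontr)
    fix u v assume uv: "u \<in> pverts G" "v \<in> pverts G" "f u = f v" "u \<noteq> v"
    then have "\<chi> (f u \<ominus> f v) = 0"
      using f(1) by simp
    then show False
      using f(2)[OF uv(1,2,4)] by (simp add: s_def split: if_splits)
  qed
  define H where "H = \<lparr>pverts = f ` pverts G,
    parcs = parcs (paley_graph R) \<inter> (f ` pverts G) \<times> (f ` pverts G)\<rparr>"
  have wf_H: "pair_wf_digraph H"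
    by unfold_locales (auto simp: H_def)
  have "wf_digraph (with_proj (paley_graph R))" "wf_digraph (with_proj H)"
    using wf_H pair_wf_digraph_paley by (simp_all add: wf_digraph_wp_iff)
  then have "induced_subgraph (with_proj H) (with_proj (paley_graph R))"
    using f(1) by (auto simp: induced_subgraph_def subgraph_def compatible_def H_def)
  moreover have "digraph_iso (with_proj G) (with_proj H)"
  proof (rule digraph_isoI[where f = f])
    show "pair_wf_digraph G"
      by (rule G.pair_wf_digraph_axioms)
    show "bij_betw f (pverts G) (pverts H)"
      using inj by (simp add: H_def bij_betw_def)
    fix u v assume uv: "u \<in> pverts G" "v \<in> pverts G"
    show "(u, v) \<in> parcs G \<longleftrightarrow> (f u, f v) \<in> parcs H"
    proof (cases "u = v")
      case True
      then show ?thesis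
        using G.pair_no_loops[of "(u, u)"] uv f(1) by (auto simp: H_def paley_arc_iff)
    next
      case False
      then show ?thesis
        using f uv by (auto simp: H_def paley_arc_iff s_def)
    qed
  qed (rule wf_H)
  ultimately show ?thesis
    unfolding embeds_induced_def by blast
qed

end

theorem theorem4p3:
  shows "(\<forall>(q::nat) (F :: ('a, 'm) ring_scheme).
            primepow q \<and> q mod 4 = 1 \<and> finite_field_of_order q F \<longrightarrow>
            metamour_complementary (paley_graph F) \<and> self_complementary (paley_graph F)) \<and>
         (\<forall>G :: 'b pair_pre_digraph. pair_graph G \<longrightarrow>
            (\<exists>q::nat. primepow q \<and> q mod 4 = 1 \<and>
              (\<exists>F :: int ring. finite_field_of_order q F) \<and>
              (\<forall>F :: int ring. finite_field_of_order q F \<longrightarrow> embeds_induced G (paley_graph F))))"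
proof (intro conjI allI impI)
  fix q :: nat and F :: "('a, 'm) ring_scheme"
  assume "primepow q \<and> q mod 4 = 1 \<and> finite_field_of_order q F"
  then interpret paley_field F
    by (auto simp: finite_field_of_order_def paley_field_def paley_field_axioms_def)
  show "metamour_complementary (paley_graph F)" "self_complementary (paley_graph F)"
    by (rule paley_metamour_complementary paley_self_complementary)+
next
  fix G :: "'b pair_pre_digraph"
  assume G: "pair_graph G"
  obtain p :: nat where p: "prime p" "p mod 4 = 1" "64 ^ (card (pverts G) + 1) < p"
    using exists_prime_1_mod_4_gt by blast
  interpret Z: residues_prime p "residue_ring (int p)"
    by unfold_locales (use p(1) in auto)
  have "finite_field_of_order p (residue_ring (int p))"
    using Z.is_field by (simp add: finite_field_of_order_def order_def Z.res_carrier_eq)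
  moreover have "embeds_induced G (paley_graph F)"
    if "finite_field_of_order p F" for F :: "int ring"
  proof -
    interpret paley_field F
      using that p(2)
      by (auto simp: finite_field_of_order_def paley_field_def paley_field_axioms_def)
    show ?thesis
      using G p(3) that by (intro paley_embeds_induced) (auto simp: finite_field_of_order_def)
  qed
  ultimately show "\<exists>q::nat. primepow q \<and> q mod 4 = 1 \<and>
      (\<exists>F :: int ring. finite_field_of_order q F) \<and>
      (\<forall>F :: int ring. finite_field_of_order q F \<longrightarrow> embeds_induced G (paley_graph F))"
    using p(2) primepow_prime[OF p(1)] by blast
qed

end
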